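(* Let $p$ be a point that is not a flat umbilic on a regular surface in $\mathbb{R}^3$, with Gaussian curvature $K$. (i) If $p$ is an umbilic point, then any pair of two directions are contour-conjugates at $p$. (ii) If $K(p)>0$ and $p$ is not an umbilic point, then any direction has two contour-conjugates at $p$. (iii) If $K(p)<0$, then there is no contour-conjugate at $p$ for any direction.
   Context: Choose coordinates of $\mathbb{R}^3$ so that $p$ is the origin and the surface is given near $p$ by $f(u,v)=\big(u,v,\frac{a_{20}}2u^2+\frac{a_{02}}2v^2+(\text{terms of degree}\ge3)\big)$, so that $K(p)=a_{20}a_{02}$; $p$ is umbilic iff $a_{20}=a_{02}$ and flat umbilic iff $a_{20}=a_{02}=0$. A direction at $p$ is a tangent direction represented by the unit vector $\xi(\theta)=(\cos\theta,\sin\theta,0)$, $0<\theta<\pi$. Two directions $\xi(\theta_1),\xi(\theta_2)$ are called contour-conjugate to each other at $p$ if $$\frac{a_{20}a_{02}}{(a_{20}\cos^2\theta_1+a_{02}\sin^2\theta_1)(a_{20}\cos^2\theta_2+a_{02}\sin^2\theta_2)}=1.$$ In that case the product $k_{\theta_1}k_{\theta_2}$ of the curvatures $k_{\theta_i}=a_{20}a_{02}/(a_{20}\cos^2\theta_i+a_{02}\sin^2\theta_i)$ at $p$ of the contours of the surface (images of the singular sets of the orthogonal projections of the surface in the directions $\xi(\theta_i)$) equals the Gaussian curvature $K(p)$.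
   Formalization: In (ii) the principal direction θ = π/2 is excluded, since with 0 < θ < π it has no contour-conjugate at a non-umbilic point (the only solution would be θ = 0); every other direction has exactly two contour-conjugates. *)

theory Defs
  imports "HOL-Analysis.Analysis" "HOL-Library.Landau_Symbols"
begin

text \<open>
  The next two definitions are meant for open sets of finite-dimensional spaces, where they
  are the usual classes \<open>C^k\<close> and \<open>C^\<infinity>\<close>: a map is \<open>C^(k+1)\<close> iff it is
  differentiable and all its directional derivatives are \<open>C^k\<close>.
\<close>

primrec Ck_on :: "nat \<Rightarrow> ('a::real_normed_vector) set \<Rightarrow> ('a \<Rightarrow> 'b::real_normed_vector) \<Rightarrow> bool"
  where
    "Ck_on 0 U f \<longleftrightarrow> continuous_on U f"
  | "Ck_on (Suc k) U f \<longleftrightarrow>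
       (\<forall>x\<in>U. f differentiable (at x)) \<and>
       (\<forall>v. Ck_on k U (\<lambda>x. frechet_derivative f (at x) v))"

definition smooth_on :: "('a::real_normed_vector) set \<Rightarrow> ('a \<Rightarrow> 'b::real_normed_vector) \<Rightarrow> bool"
  where "smooth_on U f \<longleftrightarrow> (\<forall>k. Ck_on k U f)"


section \<open>Regular surfaces in three-space\<close>

text \<open>A local parametrization is a smooth immersion that is a homeomorphism onto a
  relatively open subset of the surface.\<close>

definition local_parametrization ::
    "(real^3) set \<Rightarrow> (real \<times> real) set \<Rightarrow> (real \<times> real \<Rightarrow> real^3) \<Rightarrow> bool"
  where
    "local_parametrization S U X \<longleftrightarrow>
       open U \<and> smooth_on U X \<and>
       (\<forall>q\<in>U. inj (frechet_derivative X (at q))) \<and>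
       (\<exists>Y. homeomorphism U (X ` U) X Y) \<and>
       openin (top_of_set S) (X ` U)"

definition regular_surface :: "(real^3) set \<Rightarrow> bool"
  where "regular_surface S \<longleftrightarrow> (\<forall>p\<in>S. \<exists>U X. local_parametrization S U X \<and> p \<in> X ` U)"

definition d_u :: "(real \<times> real \<Rightarrow> 'b::real_normed_vector) \<Rightarrow> real \<times> real \<Rightarrow> 'b"
  where "d_u X q = frechet_derivative X (at q) (1, 0)"

definition d_v :: "(real \<times> real \<Rightarrow> 'b::real_normed_vector) \<Rightarrow> real \<times> real \<Rightarrow> 'b"
  where "d_v X q = frechet_derivative X (at q) (0, 1)"

definition unit_normal :: "(real \<times> real \<Rightarrow> real^3) \<Rightarrow> real \<times> real \<Rightarrow> real^3"
  where "unit_normal X q = sgn (cross3 (d_u X q) (d_v X q))"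

text \<open>Coefficients of the first and second fundamental forms.\<close>

definition ff_E :: "(real \<times> real \<Rightarrow> real^3) \<Rightarrow> real \<times> real \<Rightarrow> real"
  where "ff_E X q = d_u X q \<bullet> d_u X q"
definition ff_F :: "(real \<times> real \<Rightarrow> real^3) \<Rightarrow> real \<times> real \<Rightarrow> real"
  where "ff_F X q = d_u X q \<bullet> d_v X q"
definition ff_G :: "(real \<times> real \<Rightarrow> real^3) \<Rightarrow> real \<times> real \<Rightarrow> real"
  where "ff_G X q = d_v X q \<bullet> d_v X q"
definition ff_L :: "(real \<times> real \<Rightarrow> real^3) \<Rightarrow> real \<times> real \<Rightarrow> real"
  where "ff_L X q = d_u (d_u X) q \<bullet> unit_normal X q"
definition ff_M :: "(real \<times> real \<Rightarrow> real^3) \<Rightarrow> real \<times> real \<Rightarrow> real"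
  where "ff_M X q = d_u (d_v X) q \<bullet> unit_normal X q"
definition ff_N :: "(real \<times> real \<Rightarrow> real^3) \<Rightarrow> real \<times> real \<Rightarrow> real"
  where "ff_N X q = d_v (d_v X) q \<bullet> unit_normal X q"

text \<open>The following notions do not depend on the local parametrization around \<open>p\<close>.\<close>

definition gaussian_curvature :: "(real^3) set \<Rightarrow> real^3 \<Rightarrow> real"
  where
    "gaussian_curvature S p =
       (THE K. \<exists>U X q. local_parametrization S U X \<and> q \<in> U \<and> X q = p \<and>
          K = (ff_L X q * ff_N X q - (ff_M X q)\<^sup>2) / (ff_E X q * ff_G X q - (ff_F X q)\<^sup>2))"

definition umbilic :: "(real^3) set \<Rightarrow> real^3 \<Rightarrow> bool"
  where
    "umbilic S p \<longleftrightarrow>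
       (\<exists>U X q. local_parametrization S U X \<and> q \<in> U \<and> X q = p \<and>
          (\<exists>k. ff_L X q = k * ff_E X q \<and> ff_M X q = k * ff_F X q \<and> ff_N X q = k * ff_G X q))"

definition flat_umbilic :: "(real^3) set \<Rightarrow> real^3 \<Rightarrow> bool"
  where
    "flat_umbilic S p \<longleftrightarrow>
       (\<exists>U X q. local_parametrization S U X \<and> q \<in> U \<and> X q = p \<and>
          ff_L X q = 0 \<and> ff_M X q = 0 \<and> ff_N X q = 0)"


section \<open>Adapted coordinates and contour-conjugate directions\<close>

text \<open>
  A choice of Euclidean coordinates centred at \<open>p\<close> is given by an orthogonal map \<open>A\<close>: the
  point with coordinates \<open>y\<close> is \<open>p + A y\<close>.  In these coordinates the surface is, near
  \<open>p\<close>, the graph of \<open>h(u,v) = a20/2 u^2 + a02/2 v^2 + O(3)\<close>.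
\<close>

definition adapted_coordinates ::
    "(real^3) set \<Rightarrow> real^3 \<Rightarrow> (real^3 \<Rightarrow> real^3) \<Rightarrow> real \<Rightarrow> real \<Rightarrow> bool"
  where
    "adapted_coordinates S p A a20 a02 \<longleftrightarrow>
       orthogonal_transformation A \<and>
       (\<exists>U h. (0, 0) \<in> U \<and> smooth_on U h \<and>
          local_parametrization S U (\<lambda>(u, v). p + A (vector [u, v, h (u, v)])) \<and>
          (\<lambda>(u, v). h (u, v) - (a20 / 2 * u\<^sup>2 + a02 / 2 * v\<^sup>2)) \<in> O[nhds (0, 0)](\<lambda>q. norm q ^ 3))"

definition direction :: "(real^3 \<Rightarrow> real^3) \<Rightarrow> real \<Rightarrow> real^3"
  where "direction A \<theta> = A (vector [cos \<theta>, sin \<theta>, 0])"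

definition directions :: "(real^3 \<Rightarrow> real^3) \<Rightarrow> (real^3) set"
  where "directions A = direction A ` {0<..<pi}"

text \<open>
  If a factor of the denominator vanishes (asymptotic direction), the quotient is undefined in
  the usual reading; here it is \<open>0\<close>, so the condition fails, as it should.
\<close>

definition contour_conjugate ::
    "(real^3 \<Rightarrow> real^3) \<Rightarrow> real \<Rightarrow> real \<Rightarrow> real^3 \<Rightarrow> real^3 \<Rightarrow> bool"
  where
    "contour_conjugate A a20 a02 \<xi>\<^sub>1 \<xi>\<^sub>2 \<longleftrightarrow>
       (\<exists>\<theta>\<^sub>1\<in>{0<..<pi}. \<exists>\<theta>\<^sub>2\<in>{0<..<pi}. \<xi>\<^sub>1 = direction A \<theta>\<^sub>1 \<and> \<xi>\<^sub>2 = direction A \<theta>\<^sub>2 \<and>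
          (a20 * a02) /
          ((a20 * (cos \<theta>\<^sub>1)\<^sup>2 + a02 * (sin \<theta>\<^sub>1)\<^sup>2) * (a20 * (cos \<theta>\<^sub>2)\<^sup>2 + a02 * (sin \<theta>\<^sub>2)\<^sup>2)) = 1)"

lemma direction_inj:
  assumes "orthogonal_transformation A" "\<theta>\<^sub>1 \<in> {0<..<pi}" "\<theta>\<^sub>2 \<in> {0<..<pi}"
    and "direction A \<theta>\<^sub>1 = direction A \<theta>\<^sub>2"
  shows "\<theta>\<^sub>1 = \<theta>\<^sub>2"
proof -
  have "(vector [cos \<theta>\<^sub>1, sin \<theta>\<^sub>1, 0] :: real^3) = vector [cos \<theta>\<^sub>2, sin \<theta>\<^sub>2, 0]"
    using orthogonal_transformation_inj[OF assms(1)] assms(4) unfolding direction_def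
    by (rule injD)
  from arg_cong[OF this, of "\<lambda>x. x $ 1"] have "cos \<theta>\<^sub>1 = cos \<theta>\<^sub>2"
    by (simp only: vector_3)
  then show ?thesis
    using assms(2,3) by (auto intro: cos_inj_pi)
qed

text \<open>
  With angles in the open interval \<open>(0, pi)\<close>, the principal direction \<open>\<theta> = pi/2\<close> has no
  contour-conjugate at a non-umbilic point: the only solution of the defining equation is the
  other principal direction \<open>\<theta> = 0\<close>, which is not in the range.
\<close>

lemma not_contour_conjugate_principal:
  assumes A: "orthogonal_transformation A" and "a20 \<noteq> a02"
  shows "\<not> contour_conjugate A a20 a02 (direction A (pi / 2)) \<xi>"
proof
  assume "contour_conjugate A a20 a02 (direction A (pi / 2)) \<xi>"
  then obtain \<theta>\<^sub>1 \<theta>\<^sub>2 where t: "\<theta>\<^sub>1 \<in> {0<..<pi}" "\<theta>\<^sub>2 \<in> {0<..<pi}"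
    "direction A (pi / 2) = direction A \<theta>\<^sub>1"
    "(a20 * a02) /
     ((a20 * (cos \<theta>\<^sub>1)\<^sup>2 + a02 * (sin \<theta>\<^sub>1)\<^sup>2) * (a20 * (cos \<theta>\<^sub>2)\<^sup>2 + a02 * (sin \<theta>\<^sub>2)\<^sup>2)) = 1"
    unfolding contour_conjugate_def by blast
  have 1: "\<theta>\<^sub>1 = pi / 2"
    using direction_inj[OF A _ t(1) t(3)] by simp
  define k where "k = a20 * (cos \<theta>\<^sub>2)\<^sup>2 + a02 * (sin \<theta>\<^sub>2)\<^sup>2"
  have e: "(a20 * a02) / (a02 * k) = 1"
    using t(4) unfolding k_def by (simp only: 1) simp
  then have "a02 \<noteq> 0" by auto
  with e have "a20 / k = 1" by simp
  then have "a20 = k" by (metis divide_eq_1_iff)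
  moreover have "k = a20 - (a20 - a02) * (sin \<theta>\<^sub>2)\<^sup>2"
    unfolding k_def cos_squared_eq by (simp only: algebra_simps mult_1_right)
  ultimately have "(a20 - a02) * (sin \<theta>\<^sub>2)\<^sup>2 = 0" by linarith
  moreover have "sin \<theta>\<^sub>2 \<noteq> 0" using t(2) sin_gt_zero[of \<theta>\<^sub>2] by auto
  ultimately show False using \<open>a20 \<noteq> a02\<close> by simp
qed

end

theory Submission
  imports Defs
begin

text \<open>
  Write \<open>\<kappa> \<theta> = a20 cos\<^sup>2 \<theta> + a02 sin\<^sup>2 \<theta>\<close> for the normal curvature in direction \<open>\<theta>\<close>. Two directions
  are contour-conjugate iff \<open>\<kappa> \<theta>\<^sub>1 * \<kappa> \<theta>\<^sub>2 = a20 * a02 \<noteq> 0\<close>, and multiplying \<open>a20 * a02\<close> by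
  \<open>(cos\<^sup>2 \<theta>\<^sub>1 + sin\<^sup>2 \<theta>\<^sub>1) (cos\<^sup>2 \<theta>\<^sub>2 + sin\<^sup>2 \<theta>\<^sub>2) = 1\<close> gives
  \<open>\<kappa> \<theta>\<^sub>1 * \<kappa> \<theta>\<^sub>2 - a20 * a02
      = (a20 - a02) (a20 cos\<^sup>2 \<theta>\<^sub>1 cos\<^sup>2 \<theta>\<^sub>2 - a02 sin\<^sup>2 \<theta>\<^sub>1 sin\<^sup>2 \<theta>\<^sub>2)\<close>.
  (\<open>contour_conjugate_direction_iff\<close>). If \<open>a20 = a02\<close>, the right-hand side is always zero.
  Otherwise, for \<open>\<theta>\<^sub>1\<close> and \<open>\<theta>\<^sub>2\<close> different from \<open>pi / 2\<close>, it vanishes iff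
  \<open>tan\<^sup>2 \<theta>\<^sub>1 tan\<^sup>2 \<theta>\<^sub>2 = a20 / a02\<close>. If \<open>a20\<close> and \<open>a02\<close> have the same sign, this has exactly two
  solutions \<open>\<theta>\<^sub>2\<close>, which are symmetric about \<open>pi / 2\<close> (\<open>card_contour_conjugates\<close>). If they have
  opposite signs, the second factor is a sum of two terms of the same sign, the last one nonzero,
  and there is no solution at all (\<open>not_contour_conjugate_if_hyperbolic\<close>).

  The other half of the proof translates the geometric hypotheses, which speak of arbitrary
  parametrizations, into conditions on the two coefficients: \<open>K = a20 * a02\<close>, \<open>p\<close> is umbilic iff
  \<open>a20 = a02\<close>, and it is a flat umbilic if both vanish. For any parametrization \<open>X\<close> with
  \<open>X q = p\<close>, let \<open>u\<close>, \<open>v\<close> and \<open>w\<close> be the adapted coordinates of \<open>X\<close>. Near \<open>q\<close> the image of \<open>X\<close>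
  lies on the graph of \<open>h\<close>, so \<open>w = h (u, v)\<close>, and \<open>w\<close> differs from
  \<open>(a20 * u\<^sup>2 + a02 * v\<^sup>2) / 2\<close> by a term of third order in the distance to \<open>q\<close>. The first and
  second derivatives of such a term vanish at \<open>q\<close>, hence the fundamental forms of \<open>X\<close> at \<open>q\<close> are \<open>J\<^sup>T J\<close> and
  \<open>\<plusminus> J\<^sup>T diag (a20, a02) J\<close>, where \<open>J\<close> is the invertible Jacobian matrix of \<open>(u, v)\<close>
  (\<open>fundamental_forms_in_adapted_coordinates\<close>).
\<close>

section \<open>Functions vanishing faster than quadratically\<close>

lemma has_derivative_zero_if_small:
  fixes f :: "'a::real_normed_vector \<Rightarrow> real"
  assumes "f \<in> o[nhds x\<^sub>0](\<lambda>x. norm (x - x\<^sub>0))"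
  shows "(f has_derivative (\<lambda>_. 0)) (at x\<^sub>0)"
proof -
  have bound: "\<forall>\<^sub>F x in nhds x\<^sub>0. \<bar>f x\<bar> \<le> e * norm (x - x\<^sub>0)" if "e > 0" for e
    using landau_o.smallD[OF assms that] by simp
  have f0: "f x\<^sub>0 = 0"
    using eventually_nhds_x_imp_x[OF bound[OF zero_less_one]] by simp
  show ?thesis
    unfolding has_derivative_at_alt
  proof (intro conjI allI impI)
    fix e :: real assume "e > 0"
    from bound[OF this] obtain d where "d > 0" "\<And>x. dist x x\<^sub>0 < d \<Longrightarrow> \<bar>f x\<bar> \<le> e * norm (x - x\<^sub>0)"
      unfolding eventually_nhds_metric by blast
    then show "\<exists>d>0. \<forall>y. norm (y - x\<^sub>0) < d \<longrightarrow> norm (f y - f x\<^sub>0 - 0) \<le> e * norm (y - x\<^sub>0)"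
      by (intro exI[of _ d]) (auto simp: f0 dist_norm)
  qed simp
qed

lemma smallo_norm_if_smallo_norm_square:
  fixes f :: "'a::real_normed_vector \<Rightarrow> real"
  assumes "f \<in> o[nhds x\<^sub>0](\<lambda>x. (norm (x - x\<^sub>0))\<^sup>2)"
  shows "f \<in> o[nhds x\<^sub>0](\<lambda>x. norm (x - x\<^sub>0))"
proof (rule landau_o.small_big_trans[OF assms], rule bigoI[of _ 1])
  show "\<forall>\<^sub>F x in nhds x\<^sub>0. norm ((norm (x - x\<^sub>0))\<^sup>2) \<le> 1 * norm (norm (x - x\<^sub>0))"
    unfolding eventually_nhds_metric
    by (intro exI[of _ 1]) (auto simp: dist_norm power2_eq_square mult_left_le)
qed

text \<open>
  Restricting \<open>f\<close> to lines through \<open>x\<^sub>0\<close> would control only the symmetric part of the second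
  derivative; comparing the values of \<open>f\<close> along an edge of a triangle controls all of it. The
  directional derivative of \<open>f\<close> along \<open>a\<close> at \<open>x\<^sub>0 + t b + s a\<close> is \<open>t L b + s L a + o(t)\<close> for
  \<open>0 \<le> s \<le> t\<close>. By the mean value theorem in \<open>s\<close>, the difference
  \<open>f (x\<^sub>0 + t b + t a) - f (x\<^sub>0 + t b)\<close> is \<open>t\<^sup>2 (L b + L a / 2) + o(t\<^sup>2)\<close>; as it is also
  \<open>o(t\<^sup>2)\<close>, \<open>L b + L a / 2 = 0\<close> for every \<open>b\<close>. The case \<open>b = 0\<close> removes the second summand.
\<close>

lemma second_derivative_zero_if_small:
  fixes f :: "'a::real_normed_vector \<Rightarrow> real"
  assumes diff: "\<forall>\<^sub>F x in nhds x\<^sub>0. f differentiable (at x)"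
    and L: "((\<lambda>x. frechet_derivative f (at x) a) has_derivative L) (at x\<^sub>0)"
    and small: "f \<in> o[nhds x\<^sub>0](\<lambda>x. (norm (x - x\<^sub>0))\<^sup>2)"
  shows "L b = 0"
proof -
  interpret L: bounded_linear L by (rule has_derivative_bounded_linear[OF L])
  from has_derivative_zero_if_small[OF smallo_norm_if_smallo_norm_square[OF small]]
  have Df0: "frechet_derivative f (at x\<^sub>0) = (\<lambda>_. 0)"
    using frechet_derivative_at by metis
  have eq: "L b + L a / 2 = 0" for b
  proof -
    define c where "c = norm a + norm b"
    have c: "c \<ge> 0" by (simp add: c_def)
    have est: "\<bar>L b + L a / 2\<bar> \<le> e * (c + 2 * c\<^sup>2)" if "e > 0" for e
    proof -
      obtain d\<^sub>1 where d1: "d\<^sub>1 > 0" "\<And>x. norm (x - x\<^sub>0) < d\<^sub>1 \<Longrightarrow> f differentiable (at x)"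
        using diff unfolding eventually_nhds_metric dist_norm by blast
      obtain d\<^sub>2 where d2: "d\<^sub>2 > 0" "\<And>x. norm (x - x\<^sub>0) < d\<^sub>2 \<Longrightarrow>
          \<bar>frechet_derivative f (at x) a - L (x - x\<^sub>0)\<bar> \<le> e * norm (x - x\<^sub>0)"
        using L \<open>e > 0\<close> unfolding has_derivative_at_alt Df0 by fastforce
      have "\<forall>\<^sub>F x in nhds x\<^sub>0. \<bar>f x\<bar> \<le> e * (norm (x - x\<^sub>0))\<^sup>2"
        using landau_o.smallD[OF small \<open>e > 0\<close>] by simp
      then obtain d\<^sub>3 where d3: "d\<^sub>3 > 0"
          "\<And>x. norm (x - x\<^sub>0) < d\<^sub>3 \<Longrightarrow> \<bar>f x\<bar> \<le> e * (norm (x - x\<^sub>0))\<^sup>2"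
        unfolding eventually_nhds_metric dist_norm by blast
      \<comment> \<open>so small that the triangle \<open>t b + s a\<close>, \<open>0 \<le> s \<le> t\<close>, lies in all three balls\<close>
      define t where "t = min d\<^sub>1 (min d\<^sub>2 d\<^sub>3) / (c + 1)"
      have t: "t > 0" using d1 d2 d3 c by (simp add: t_def)
      have "t * c < t * (c + 1)" using t by simp
      also have "\<dots> = min d\<^sub>1 (min d\<^sub>2 d\<^sub>3)" using c by (simp add: t_def)
      finally have tc: "t * c < d\<^sub>1" "t * c < d\<^sub>2" "t * c < d\<^sub>3" by auto
      have nrm: "norm (t *\<^sub>R b + s *\<^sub>R a) \<le> t * c" if "0 \<le> s" "s \<le> t" for s
      proof -
        have "norm (t *\<^sub>R b + s *\<^sub>R a) \<le> t * norm b + s * norm a"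
          using norm_triangle_ineq[of "t *\<^sub>R b" "s *\<^sub>R a"] that t by simp
        also have "\<dots> \<le> t * norm b + t * norm a" using that by (simp add: mult_right_mono)
        finally show ?thesis by (simp add: c_def algebra_simps)
      qed
      define y where "y s = x\<^sub>0 + (t *\<^sub>R b + s *\<^sub>R a)" for s
      \<comment> \<open>subtract the primitive in \<open>s\<close> of the linear part \<open>t L b + s L a\<close>\<close>
      define \<psi> where "\<psi> s = f (y s) - (s * t * L b + s\<^sup>2 / 2 * L a)" for s
      define \<psi>' where "\<psi>' s = frechet_derivative f (at (y s)) a - L (y s - x\<^sub>0)" for s
      have der: "DERIV \<psi> s :> \<psi>' s" if "0 \<le> s" "s \<le> t" for s
      proof -
        have "norm (y s - x\<^sub>0) < d\<^sub>1" using nrm[OF that] tc by (simp add: y_def)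
        from d1(2)[OF this]
        have fd: "(f has_derivative frechet_derivative f (at (y s))) (at (y s))"
          by (simp add: frechet_derivative_works)
        have "(y has_derivative (\<lambda>r. r *\<^sub>R a)) (at s)"
          unfolding y_def by (auto intro!: derivative_eq_intros)
        from has_derivative_compose[OF this fd]
        have "((\<lambda>s. f (y s)) has_derivative (\<lambda>r. r * frechet_derivative f (at (y s)) a)) (at s)"
          using linear_frechet_derivative[OF d1(2)[OF \<open>norm (y s - x\<^sub>0) < d\<^sub>1\<close>]]
          by (simp add: linear_cmul)
        then have "DERIV (\<lambda>s. f (y s)) s :> frechet_derivative f (at (y s)) a"
          by (simp add: has_field_derivative_def mult.commute[of _ "frechet_derivative f (at (y s)) a"])
        then show ?thesis
          unfolding \<psi>_def \<psi>'_def
          by (auto intro!: derivative_eq_intros simp: y_def L.add L.scaleR algebra_simps)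
      qed
      obtain z where z: "0 < z" "z < t" "\<psi> t - \<psi> 0 = (t - 0) * \<psi>' z"
        using MVT2[OF t der] by blast
      have "\<bar>\<psi>' z\<bar> \<le> e * norm (y z - x\<^sub>0)"
        unfolding \<psi>'_def using nrm[of z] z tc by (intro d2(2)) (simp add: y_def)
      also have "\<dots> \<le> e * (t * c)"
        using nrm[of z] z \<open>e > 0\<close> by (simp add: y_def)
      finally have "\<bar>\<psi> t - \<psi> 0\<bar> \<le> t * (e * (t * c))"
        using t z(3) by (simp add: abs_mult)
      moreover have fy: "\<bar>f (y s)\<bar> \<le> e * (t * c)\<^sup>2" if "0 \<le> s" "s \<le> t" for s
      proof -
        have "\<bar>f (y s)\<bar> \<le> e * (norm (y s - x\<^sub>0))\<^sup>2"
          using nrm[OF that] tc by (intro d3(2)) (simp add: y_def)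
        also have "\<dots> \<le> e * (t * c)\<^sup>2"
          using nrm[OF that] \<open>e > 0\<close> by (simp add: y_def power_mono)
        finally show ?thesis .
      qed
      moreover have "\<psi> t - \<psi> 0 = f (y t) - f (y 0) - t\<^sup>2 * (L b + L a / 2)"
        by (simp add: \<psi>_def algebra_simps power2_eq_square)
      ultimately have "\<bar>t\<^sup>2 * (L b + L a / 2)\<bar> \<le> t * (e * (t * c)) + 2 * (e * (t * c)\<^sup>2)"
        using fy[of 0] fy[of t] t by linarith
      also have "\<dots> = t\<^sup>2 * (e * (c + 2 * c\<^sup>2))"
        by (simp add: algebra_simps power2_eq_square)
      finally have "t\<^sup>2 * \<bar>L b + L a / 2\<bar> \<le> t\<^sup>2 * (e * (c + 2 * c\<^sup>2))"
        by (simp add: abs_mult)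
      then show ?thesis using t by simp
    qed
    define C where "C = c + 2 * c\<^sup>2"
    have "C \<ge> 0" using c by (simp add: C_def)
    have "\<bar>L b + L a / 2\<bar> \<le> 0 + e" if "e > 0" for e
    proof -
      have "\<bar>L b + L a / 2\<bar> \<le> e / (C + 1) * C"
        using est[of "e / (C + 1)"] that \<open>C \<ge> 0\<close> by (simp add: C_def)
      also have "\<dots> \<le> e" using that \<open>C \<ge> 0\<close> by (simp add: field_simps)
      finally show ?thesis by simp
    qed
    from field_le_epsilon[OF this] show ?thesis by simp
  qed
  have "L a = 0" using eq[of 0] by (simp add: L.zero)
  then show ?thesis using eq[of b] by simp
qed

section \<open>The fundamental forms in adapted coordinates\<close>

lemma orthogonal_transformation_coordinates:
  fixes A :: "real^3 \<Rightarrow> real^3"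
  assumes "orthogonal_transformation A"
  shows "A (vector [x \<bullet> A (axis 1 1), x \<bullet> A (axis 2 1), x \<bullet> A (axis 3 1)]) = x"
proof -
  obtain y where y: "x = A y" using orthogonal_transformation_surj[OF assms] by (metis surjD)
  have "x \<bullet> A (axis i 1) = y $ i" for i
    using assms unfolding y orthogonal_transformation_def by (simp add: inner_axis)
  moreover have "vector [y $ 1, y $ 2, y $ 3] = y" by (simp add: vec_eq_iff forall_3)
  ultimately show ?thesis using y by simp
qed

lemma parametrization_derivatives:
  assumes "local_parametrization S U X" "x \<in> U"
  shows "(X has_derivative frechet_derivative X (at x)) (at x)"
    and "((\<lambda>x. frechet_derivative X (at x) a) has_derivative
      frechet_derivative (\<lambda>x. frechet_derivative X (at x) a) (at x)) (at x)"
proof -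
  have "Ck_on (Suc (Suc 0)) U X" using assms unfolding local_parametrization_def smooth_on_def by blast
  then show "(X has_derivative frechet_derivative X (at x)) (at x)"
    "((\<lambda>x. frechet_derivative X (at x) a) has_derivative
      frechet_derivative (\<lambda>x. frechet_derivative X (at x) a) (at x)) (at x)"
    using assms(2) unfolding Ck_on.simps frechet_derivative_works by blast+
qed

lemma has_derivative_imp_pointwise_Lipschitz:
  assumes "(f has_derivative D) (at x\<^sub>0)"
  obtains B where "B > 0" "\<forall>\<^sub>F x in nhds x\<^sub>0. norm (f x - f x\<^sub>0) \<le> B * norm (x - x\<^sub>0)"
proof -
  interpret D: bounded_linear D by (rule has_derivative_bounded_linear[OF assms])
  obtain K where K: "K > 0" "\<And>x. norm (D x) \<le> norm x * K" using D.pos_bounded by blast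
  obtain d where d: "d > 0" "\<And>y. norm (y - x\<^sub>0) < d \<Longrightarrow> norm (f y - f x\<^sub>0 - D (y - x\<^sub>0)) \<le> 1 * norm (y - x\<^sub>0)"
    using assms zero_less_one unfolding has_derivative_at_alt by blast
  have "norm (f y - f x\<^sub>0) \<le> (K + 1) * norm (y - x\<^sub>0)" if "norm (y - x\<^sub>0) < d" for y
    using d(2)[OF that] K(2)[of "y - x\<^sub>0"] norm_triangle_ineq[of "f y - f x\<^sub>0 - D (y - x\<^sub>0)" "D (y - x\<^sub>0)"]
    by (simp add: algebra_simps)
  then show thesis
    using d(1) K(1) by (intro that[of "K + 1"]) (auto simp: eventually_nhds_metric dist_norm)
qed

text \<open>
  Since \<open>X\<close> parametrizes \<open>S\<close>, and the graph of \<open>h\<close> covers a neighbourhood of \<open>p\<close> in \<open>S\<close>, the third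
  coordinate of \<open>X\<close> near \<open>q\<close> is \<open>h\<close> of the first two; these are \<open>O(norm (x - q))\<close>, so the cubic
  remainder of \<open>h\<close> is of third order in \<open>x - q\<close> as well.
\<close>

lemma height_minus_quadratic_form_small:
  assumes "adapted_coordinates S p A a20 a02"
    and X: "local_parametrization S U X" and q: "q \<in> U" "X q = p"
  shows "(\<lambda>x. (X x - p) \<bullet> A (axis 3 1) -
      (a20 / 2 * ((X x - p) \<bullet> A (axis 1 1))\<^sup>2 + a02 / 2 * ((X x - p) \<bullet> A (axis 2 1))\<^sup>2))
    \<in> o[nhds q](\<lambda>x. (norm (x - q))\<^sup>2)" (is "?g \<in> _")
proof -
  obtain W h where A: "orthogonal_transformation A" and W: "(0, 0) \<in> W"
    and G: "local_parametrization S W (\<lambda>(u, v). p + A (vector [u, v, h (u, v)]))"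
    and O: "(\<lambda>(u, v). h (u, v) - (a20 / 2 * u\<^sup>2 + a02 / 2 * v\<^sup>2)) \<in> O[nhds (0, 0)](\<lambda>q. norm q ^ 3)"
    using assms(1) unfolding adapted_coordinates_def by blast
  define Y where "Y = (\<lambda>(u, v). p + A (vector [u, v, h (u, v)]))"
  define R where "R = (\<lambda>(u, v). h (u, v) - (a20 / 2 * u\<^sup>2 + a02 / 2 * v\<^sup>2))"
  define m where "m x = ((X x - p) \<bullet> A (axis 1 1), (X x - p) \<bullet> A (axis 2 1))" for x
  have A_inner: "A y \<bullet> A (axis i 1) = y $ i" for y i
    using A unfolding orthogonal_transformation_def by (simp add: inner_axis)
  obtain c where c: "c > 0" "\<forall>\<^sub>F y in nhds (0, 0). \<bar>R y\<bar> \<le> c * norm y ^ 3"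
    using O unfolding R_def[symmetric] by (elim landau_o.bigE) auto
  have R0: "R (0, 0) = 0" using eventually_nhds_x_imp_x[OF c(2)] by simp
  have p: "p \<in> Y ` W"
  proof -
    have "vector [0, 0, 0 :: real] = (0 :: real^3)" by (simp add: vec_eq_iff forall_3)
    then have "Y (0, 0) = p" 
      using R0 linear_0[OF orthogonal_transformation_linear[OF A]] by (simp add: Y_def R_def)
    then show ?thesis using W by (metis imageI)
  qed
  obtain T where T: "open T" "Y ` W = S \<inter> T"
    using G unfolding local_parametrization_def Y_def[symmetric] openin_open by blast
  have XS: "X ` U \<subseteq> S" and "open U"
    using X unfolding local_parametrization_def by (auto dest: openin_imp_subset)
  have Xq: "(X has_derivative frechet_derivative X (at q)) (at q)"
    by (rule parametrization_derivatives(1)[OF X q(1)])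
  then have cont: "isCont X q" by (rule has_derivative_continuous)
  have lim: "filterlim X (nhds p) (nhds q)"
    using cont q unfolding isCont_def tendsto_at_iff_tendsto_nhds by simp
  have "\<forall>\<^sub>F x in nhds q. X x \<in> T"
    using p T by (intro eventually_compose_filterlim[OF _ lim] eventually_nhds_in_open) auto
  moreover have "\<forall>\<^sub>F x in nhds q. x \<in> U"
    using \<open>open U\<close> q by (intro eventually_nhds_in_open)
  ultimately have gR: "\<forall>\<^sub>F x in nhds q. ?g x = R (m x)"
  proof eventually_elim
    case (elim x)
    then have "X x \<in> Y ` W" using XS T by blast
    then obtain u v where uv: "X x - p = A (vector [u, v, h (u, v)])"
      unfolding Y_def by auto
    show ?case unfolding m_def R_def uv A_inner by simp
  qed
  have "((\<lambda>x. ((X x - p) \<bullet> A (axis 1 1), (X x - p) \<bullet> A (axis 2 1))) \<longlongrightarrow>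
     ((p - p) \<bullet> A (axis 1 1), (p - p) \<bullet> A (axis 2 1))) (nhds q)"
    by (intro tendsto_intros lim)
  then have "filterlim m (nhds (0, 0)) (nhds q)"
    by (simp add: m_def[abs_def])
  from eventually_compose_filterlim[OF c(2) this]
  have Rm: "\<forall>\<^sub>F x in nhds q. \<bar>R (m x)\<bar> \<le> c * norm (m x) ^ 3" .
  obtain B where B: "B > 0" "\<forall>\<^sub>F x in nhds q. norm (X x - X q) \<le> B * norm (x - q)"
    by (rule has_derivative_imp_pointwise_Lipschitz[OF Xq])
  have axis: "norm (A (axis i 1)) = 1" for i
    using A by (simp add: orthogonal_transformation_norm)
  have m_le: "norm (m x) \<le> 2 * norm (X x - p)" for x
  proof -
    have "norm (m x) \<le> \<bar>(X x - p) \<bullet> A (axis 1 1)\<bar> + \<bar>(X x - p) \<bullet> A (axis 2 1)\<bar>"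
      unfolding m_def by (rule norm_Pair_le[of "(X x - p) \<bullet> A (axis 1 1)" "(X x - p) \<bullet> A (axis 2 1)", unfolded real_norm_def])
    also have "\<dots> \<le> 2 * norm (X x - p)"
      using Cauchy_Schwarz_ineq2[of "X x - p" "A (axis 1 1)"]
        Cauchy_Schwarz_ineq2[of "X x - p" "A (axis 2 1)"] by (simp add: axis)
    finally show ?thesis .
  qed
  define C where "C = c * (2 * B) ^ 3"
  have C: "C > 0" using c B by (simp add: C_def)
  have cubic: "\<forall>\<^sub>F x in nhds q. \<bar>?g x\<bar> \<le> C * norm (x - q) ^ 3"
    using gR Rm B(2)
  proof eventually_elim
    case (elim x)
    have "norm (m x) \<le> 2 * B * norm (x - q)" using elim(3) m_le[of x] q by simp
    from power_mono[OF this norm_ge_zero, of 3] c(1)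
    have "c * norm (m x) ^ 3 \<le> C * norm (x - q) ^ 3"
      by (simp add: C_def power_mult_distrib mult.assoc)
    then show ?case using elim(1,2) by simp
  qed
  show ?thesis
  proof (rule landau_o.smallI)
    fix e :: real assume e: "e > 0"
    have "\<forall>\<^sub>F x in nhds q. norm (x - q) < e / C"
      using e C unfolding eventually_nhds_metric dist_norm by (intro exI[of _ "e / C"]) auto
    with cubic show "\<forall>\<^sub>F x in nhds q. norm (?g x) \<le> e * norm ((norm (x - q))\<^sup>2)"
    proof eventually_elim
      case (elim x)
      have "C * norm (x - q) \<le> e" using elim(2) C by (simp add: field_simps)
      from mult_right_mono[OF this, of "(norm (x - q))\<^sup>2"] elim(1)
      show ?case by (simp add: power3_eq_cube power2_eq_square mult.assoc)
    qed
  qed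
qed

text \<open>
  Differentiate the small function of the preceding lemma once and twice at \<open>q\<close>. The first
  two coordinates vanish at \<open>q\<close>, so only products of their first derivatives survive.
\<close>

lemma derivatives_in_adapted_coordinates:
  assumes ad: "adapted_coordinates S p A a20 a02"
    and X: "local_parametrization S U X" and q: "q \<in> U" "X q = p"
  defines "D \<equiv> frechet_derivative X (at q)"
  shows "D a \<bullet> A (axis 3 1) = 0"
    and "frechet_derivative (\<lambda>x. frechet_derivative X (at x) a) (at q) b \<bullet> A (axis 3 1) =
      a20 * (D a \<bullet> A (axis 1 1)) * (D b \<bullet> A (axis 1 1)) +
      a02 * (D a \<bullet> A (axis 2 1)) * (D b \<bullet> A (axis 2 1))"
proof -
  define DX where "DX x = frechet_derivative X (at x)" for x
  define e where "e i = A (axis i 1)" for i :: 3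
  define g where "g x = (X x - p) \<bullet> e 3 -
      (a20 / 2 * ((X x - p) \<bullet> e 1)\<^sup>2 + a02 / 2 * ((X x - p) \<bullet> e 2)\<^sup>2)" for x
  define G where "G x a = DX x a \<bullet> e 3 - (a20 * ((X x - p) \<bullet> e 1) * (DX x a \<bullet> e 1) +
      a02 * ((X x - p) \<bullet> e 2) * (DX x a \<bullet> e 2))" for x a
  have small: "g \<in> o[nhds q](\<lambda>x. (norm (x - q))\<^sup>2)"
    using height_minus_quadratic_form_small[OF ad X q] by (simp add: g_def[abs_def] e_def)
  have "open U" using X by (simp add: local_parametrization_def)
  have dX: "(X has_derivative DX x) (at x)" if "x \<in> U" for x
    unfolding DX_def by (rule parametrization_derivatives(1)[OF X that])
  have dg: "(g has_derivative G x) (at x)" if "x \<in> U" for x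
  proof -
    have "(g has_derivative (\<lambda>d. DX x d \<bullet> e 3 -
        (a20 / 2 * (2 * ((X x - p) \<bullet> e 1) * (DX x d \<bullet> e 1)) +
         a02 / 2 * (2 * ((X x - p) \<bullet> e 2) * (DX x d \<bullet> e 2))))) (at x)"
      unfolding g_def
      by (rule derivative_eq_intros dX[OF that] refl | simp add: ac_simps)+
    then show ?thesis by (simp add: G_def[abs_def] mult.assoc mult.left_commute mult.commute)
  qed
  then have fg: "frechet_derivative g (at x) = G x" if "x \<in> U" for x
    using frechet_derivative_at that by metis
  define H where "H = frechet_derivative (\<lambda>x. frechet_derivative X (at x) a) (at q)"
  have dDX: "((\<lambda>x. DX x a) has_derivative H) (at q)"
    unfolding DX_def H_def by (rule parametrization_derivatives(2)[OF X q(1)])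
  define L where "L b = H b \<bullet> e 3 - (a20 * (DX q b \<bullet> e 1) * (DX q a \<bullet> e 1) +
      a02 * (DX q b \<bullet> e 2) * (DX q a \<bullet> e 2))" for b
  have "((\<lambda>x. G x a) has_derivative L) (at q)"
    unfolding G_def L_def
    by (rule derivative_eq_intros dX[OF q(1)] dDX refl | simp add: q)+
  then have "((\<lambda>x. frechet_derivative g (at x) a) has_derivative L) (at q)"
    by (rule has_derivative_transform_within_open[OF _ \<open>open U\<close> q(1)]) (simp add: fg)
  moreover have "\<forall>\<^sub>F x in nhds q. g differentiable (at x)"
    using eventually_nhds_in_open[OF \<open>open U\<close> q(1)] 
    by eventually_elim (use dg differentiableI in blast)
  ultimately have "L b = 0"
    using small by (intro second_derivative_zero_if_small)
  then show "frechet_derivative (\<lambda>x. frechet_derivative X (at x) a) (at q) b \<bullet> A (axis 3 1) =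
      a20 * (D a \<bullet> A (axis 1 1)) * (D b \<bullet> A (axis 1 1)) +
      a02 * (D a \<bullet> A (axis 2 1)) * (D b \<bullet> A (axis 2 1))"
    unfolding L_def H_def DX_def D_def e_def by (simp add: algebra_simps)
  have "(g has_derivative (\<lambda>_. 0)) (at q)"
    by (rule has_derivative_zero_if_small[OF smallo_norm_if_smallo_norm_square[OF small]])
  then have "G q = (\<lambda>_. 0)" using dg[OF q(1)] has_derivative_unique by blast
  then have "G q a = 0" by simp
  then show "D a \<bullet> A (axis 3 1) = 0" by (simp add: G_def D_def DX_def e_def q)
qed

text \<open>
  Here \<open>(u\<^sub>1, v\<^sub>1)\<close> and \<open>(u\<^sub>2, v\<^sub>2)\<close> are the adapted coordinates of the two tangent vectors
  \<open>d_u X q\<close> and \<open>d_v X q\<close>, the columns of \<open>J\<close>. The sign \<open>\<sigma>\<close> records whether the unit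
  normal of \<open>X\<close> is the positive or the negative third axis; it cancels in \<open>K\<close> and is absorbed by
  the factor in the definition of an umbilic.
\<close>

lemma fundamental_forms_in_adapted_coordinates:
  assumes ad: "adapted_coordinates S p A a20 a02"
    and X: "local_parametrization S U X" and q: "q \<in> U" "X q = p"
  obtains u\<^sub>1 v\<^sub>1 u\<^sub>2 v\<^sub>2 \<sigma> :: real where
    "u\<^sub>1 * v\<^sub>2 - u\<^sub>2 * v\<^sub>1 \<noteq> 0" "\<sigma>\<^sup>2 = 1"
    "ff_E X q = u\<^sub>1\<^sup>2 + v\<^sub>1\<^sup>2" "ff_F X q = u\<^sub>1 * u\<^sub>2 + v\<^sub>1 * v\<^sub>2" "ff_G X q = u\<^sub>2\<^sup>2 + v\<^sub>2\<^sup>2"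
    "ff_L X q = \<sigma> * (a20 * u\<^sub>1\<^sup>2 + a02 * v\<^sub>1\<^sup>2)"
    "ff_M X q = \<sigma> * (a20 * u\<^sub>1 * u\<^sub>2 + a02 * v\<^sub>1 * v\<^sub>2)"
    "ff_N X q = \<sigma> * (a20 * u\<^sub>2\<^sup>2 + a02 * v\<^sub>2\<^sup>2)"
proof -
  have A: "orthogonal_transformation A" using ad by (simp add: adapted_coordinates_def)
  have inner_A: "A x \<bullet> A y = x \<bullet> y" for x y
    using A by (simp add: orthogonal_transformation_def)
  interpret A: linear A by (rule orthogonal_transformation_linear[OF A])
  define D where "D = frechet_derivative X (at q)"
  note D_props = derivatives_in_adapted_coordinates[OF ad X q, folded D_def]
  define u\<^sub>1 v\<^sub>1 u\<^sub>2 v\<^sub>2 where "u\<^sub>1 = D (1, 0) \<bullet> A (axis 1 1)" and "v\<^sub>1 = D (1, 0) \<bullet> A (axis 2 1)"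
    and "u\<^sub>2 = D (0, 1) \<bullet> A (axis 1 1)" and "v\<^sub>2 = D (0, 1) \<bullet> A (axis 2 1)"
  note uv = this
  have Xu: "d_u X q = A (vector [u\<^sub>1, v\<^sub>1, 0])" and Xv: "d_v X q = A (vector [u\<^sub>2, v\<^sub>2, 0])"
    using orthogonal_transformation_coordinates[OF A, of "D (1, 0)"]
      orthogonal_transformation_coordinates[OF A, of "D (0, 1)"] D_props(1)
    by (auto simp: uv d_u_def d_v_def D_def)
  interpret D: linear D
    unfolding D_def using parametrization_derivatives(1)[OF X q(1)] 
    by (rule has_derivative_linear)
  have D_eq: "D (x, y) = A (vector [x * u\<^sub>1 + y * u\<^sub>2, x * v\<^sub>1 + y * v\<^sub>2, 0])" for x y
  proof -
    have "D (x, y) = D (x *\<^sub>R (1, 0) + y *\<^sub>R (0, 1))" by simp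
    also have "\<dots> = x *\<^sub>R d_u X q + y *\<^sub>R d_v X q"
      unfolding D.add D.scaleR by (simp add: D_def d_u_def d_v_def)
    also have "\<dots> = A (x *\<^sub>R vector [u\<^sub>1, v\<^sub>1, 0] + y *\<^sub>R vector [u\<^sub>2, v\<^sub>2, 0])"
      by (simp add: Xu Xv A.add A.scaleR)
    also have "x *\<^sub>R vector [u\<^sub>1, v\<^sub>1, 0] + y *\<^sub>R vector [u\<^sub>2, v\<^sub>2, 0] =
        (vector [x * u\<^sub>1 + y * u\<^sub>2, x * v\<^sub>1 + y * v\<^sub>2, 0] :: real^3)"
      by (simp add: vec_eq_iff forall_3)
    finally show ?thesis .
  qed
  have "inj D" using X q unfolding local_parametrization_def D_def by blast
  have ker: "x = 0 \<and> y = 0" if "x * u\<^sub>1 + y * u\<^sub>2 = 0" "x * v\<^sub>1 + y * v\<^sub>2 = 0" for x y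
    using injD[OF \<open>inj D\<close>, of "(x, y)" "(0, 0)"] that by (simp add: D_eq)
  \<comment> \<open>otherwise \<open>(v\<^sub>2, - v\<^sub>1)\<close> and \<open>(u\<^sub>2, - u\<^sub>1)\<close> lie in the kernel of \<open>D\<close>\<close>
  have det: "u\<^sub>1 * v\<^sub>2 - u\<^sub>2 * v\<^sub>1 \<noteq> 0"
  proof
    assume 0: "u\<^sub>1 * v\<^sub>2 - u\<^sub>2 * v\<^sub>1 = 0"
    have "v\<^sub>2 = 0 \<and> - v\<^sub>1 = 0" using 0 by (intro ker) (simp_all add: algebra_simps)
    moreover have "u\<^sub>2 = 0 \<and> - u\<^sub>1 = 0" using 0 by (intro ker) (simp_all add: algebra_simps)
    ultimately show False using ker[of 1 0] by simp
  qed
  define \<sigma> where "\<sigma> = det (matrix A) * sgn (u\<^sub>1 * v\<^sub>2 - u\<^sub>2 * v\<^sub>1)"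
  have detA: "\<bar>det (matrix A)\<bar> = 1"
    using A det_orthogonal_matrix[of "matrix A"] orthogonal_transformation_matrix[of A] by auto
  have "\<bar>\<sigma>\<bar> = 1" using detA det by (simp add: \<sigma>_def abs_mult abs_sgn_eq)
  then have \<sigma>: "\<sigma>\<^sup>2 = 1" using abs_square_eq_1 by blast
  have cr: "cross3 (vector [u\<^sub>1, v\<^sub>1, 0]) (vector [u\<^sub>2, v\<^sub>2, 0]) = (u\<^sub>1 * v\<^sub>2 - u\<^sub>2 * v\<^sub>1) *\<^sub>R axis 3 (1::real)"
    by (simp add: cross3_def vec_eq_iff forall_3 axis_def)
  have nrm: "norm (A (axis 3 1)) = 1" using A by (simp add: orthogonal_transformation_norm)
  have sgnA: "sgn (A (axis 3 1)) = A (axis 3 1)" by (simp add: sgn_div_norm nrm)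
  have normal: "unit_normal X q = \<sigma> *\<^sub>R A (axis 3 1)"
  proof -
    have "sgn (det (matrix A)) = det (matrix A)" using detA by (auto simp: sgn_if abs_if split: if_splits)
    then show ?thesis
      unfolding unit_normal_def Xu Xv cross_orthogonal_transformation[OF A] cr A.scaleR
      by (simp add: sgn_scaleR sgnA \<sigma>_def sgn_mult)
  qed
  have inner3: "vector [a, b, 0] \<bullet> (vector [c, d, 0] :: real^3) = a * c + b * d" for a b c d :: real
    by (simp add: inner_vec_def sum_3)
  show thesis
  proof (rule that[OF det \<sigma>])
    show "ff_E X q = u\<^sub>1\<^sup>2 + v\<^sub>1\<^sup>2" "ff_F X q = u\<^sub>1 * u\<^sub>2 + v\<^sub>1 * v\<^sub>2" "ff_G X q = u\<^sub>2\<^sup>2 + v\<^sub>2\<^sup>2"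
      by (simp_all add: ff_E_def ff_F_def ff_G_def Xu Xv inner_A inner3 power2_eq_square)
    show "ff_L X q = \<sigma> * (a20 * u\<^sub>1\<^sup>2 + a02 * v\<^sub>1\<^sup>2)"
      "ff_M X q = \<sigma> * (a20 * u\<^sub>1 * u\<^sub>2 + a02 * v\<^sub>1 * v\<^sub>2)"
      "ff_N X q = \<sigma> * (a20 * u\<^sub>2\<^sup>2 + a02 * v\<^sub>2\<^sup>2)"
      unfolding ff_L_def ff_M_def ff_N_def normal inner_scaleR_right
      using D_props(2)[of "(1,0)" "(1,0)"] D_props(2)[of "(0,1)" "(1,0)"] D_props(2)[of "(0,1)" "(0,1)"]
      by (simp_all add: d_u_def[abs_def] d_v_def[abs_def] uv power2_eq_square ac_simps)
  qed
qed

section \<open>Curvature and umbilicity in adapted coordinates\<close>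

lemma gaussian_curvature_adapted:
  assumes "regular_surface S" "p \<in> S" and ad: "adapted_coordinates S p A a20 a02"
  shows "gaussian_curvature S p = a20 * a02"
proof -
  have K: "(ff_L X q * ff_N X q - (ff_M X q)\<^sup>2) / (ff_E X q * ff_G X q - (ff_F X q)\<^sup>2) = a20 * a02"
    if X: "local_parametrization S U X" "q \<in> U" "X q = p" for U X q
  proof -
    obtain u\<^sub>1 v\<^sub>1 u\<^sub>2 v\<^sub>2 \<sigma> where f: 
      "u\<^sub>1 * v\<^sub>2 - u\<^sub>2 * v\<^sub>1 \<noteq> 0" "\<sigma>\<^sup>2 = 1"
      "ff_E X q = u\<^sub>1\<^sup>2 + v\<^sub>1\<^sup>2" "ff_F X q = u\<^sub>1 * u\<^sub>2 + v\<^sub>1 * v\<^sub>2" "ff_G X q = u\<^sub>2\<^sup>2 + v\<^sub>2\<^sup>2"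
      "ff_L X q = \<sigma> * (a20 * u\<^sub>1\<^sup>2 + a02 * v\<^sub>1\<^sup>2)"
      "ff_M X q = \<sigma> * (a20 * u\<^sub>1 * u\<^sub>2 + a02 * v\<^sub>1 * v\<^sub>2)"
      "ff_N X q = \<sigma> * (a20 * u\<^sub>2\<^sup>2 + a02 * v\<^sub>2\<^sup>2)"
      using fundamental_forms_in_adapted_coordinates[OF ad X] by metis
    have "ff_E X q * ff_G X q - (ff_F X q)\<^sup>2 = (u\<^sub>1 * v\<^sub>2 - u\<^sub>2 * v\<^sub>1)\<^sup>2"
      unfolding f by algebra
    moreover have "ff_L X q * ff_N X q - (ff_M X q)\<^sup>2 = \<sigma>\<^sup>2 * (a20 * a02) * (u\<^sub>1 * v\<^sub>2 - u\<^sub>2 * v\<^sub>1)\<^sup>2"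
      unfolding f(6-8) by algebra
    ultimately show ?thesis using f(1,2) by simp
  qed
  obtain U X q where "local_parametrization S U X" "q \<in> U" "X q = p"
    using assms(1,2) unfolding regular_surface_def by (metis imageE)
  then show ?thesis
    unfolding gaussian_curvature_def by (intro the_equality) (use K in metis)+
qed

lemma umbilic_adapted:
  assumes "regular_surface S" "p \<in> S" and ad: "adapted_coordinates S p A a20 a02"
  shows "umbilic S p \<longleftrightarrow> a20 = a02"
proof
  assume "umbilic S p"
  then obtain U X q k where X: "local_parametrization S U X" "q \<in> U" "X q = p"
    and k: "ff_L X q = k * ff_E X q" "ff_M X q = k * ff_F X q" "ff_N X q = k * ff_G X q"
    unfolding umbilic_def by blast
  obtain u\<^sub>1 v\<^sub>1 u\<^sub>2 v\<^sub>2 \<sigma> where f: 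
    "u\<^sub>1 * v\<^sub>2 - u\<^sub>2 * v\<^sub>1 \<noteq> 0" "\<sigma>\<^sup>2 = 1"
    "ff_E X q = u\<^sub>1\<^sup>2 + v\<^sub>1\<^sup>2" "ff_F X q = u\<^sub>1 * u\<^sub>2 + v\<^sub>1 * v\<^sub>2" "ff_G X q = u\<^sub>2\<^sup>2 + v\<^sub>2\<^sup>2"
    "ff_L X q = \<sigma> * (a20 * u\<^sub>1\<^sup>2 + a02 * v\<^sub>1\<^sup>2)"
    "ff_M X q = \<sigma> * (a20 * u\<^sub>1 * u\<^sub>2 + a02 * v\<^sub>1 * v\<^sub>2)"
    "ff_N X q = \<sigma> * (a20 * u\<^sub>2\<^sup>2 + a02 * v\<^sub>2\<^sup>2)"
    using fundamental_forms_in_adapted_coordinates[OF ad X] by metis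
  \<comment> \<open>Multiply \<open>J\<^sup>T diag (\<sigma> a20 - k, \<sigma> a02 - k) J = 0\<close> on both sides by the adjugate matrices.\<close>
  have "(\<sigma> * a20 - k) * (u\<^sub>1 * v\<^sub>2 - u\<^sub>2 * v\<^sub>1)\<^sup>2 = 0" "(\<sigma> * a02 - k) * (u\<^sub>1 * v\<^sub>2 - u\<^sub>2 * v\<^sub>1)\<^sup>2 = 0"
    using k unfolding f by algebra+
  then have "\<sigma> * a20 = \<sigma> * a02" using f(1) by simp
  moreover have "\<sigma> \<noteq> 0" using f(2) by auto
  ultimately show "a20 = a02" by simp
next
  assume eq: "a20 = a02"
  obtain U X q where X: "local_parametrization S U X" "q \<in> U" "X q = p"
    using assms(1,2) unfolding regular_surface_def by (metis imageE)
  have "\<exists>k. ff_L X q = k * ff_E X q \<and> ff_M X q = k * ff_F X q \<and> ff_N X q = k * ff_G X q"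
  proof (rule fundamental_forms_in_adapted_coordinates[OF ad X], intro exI)
    fix u\<^sub>1 v\<^sub>1 u\<^sub>2 v\<^sub>2 \<sigma>
    assume "ff_E X q = u\<^sub>1\<^sup>2 + v\<^sub>1\<^sup>2" "ff_F X q = u\<^sub>1 * u\<^sub>2 + v\<^sub>1 * v\<^sub>2" "ff_G X q = u\<^sub>2\<^sup>2 + v\<^sub>2\<^sup>2"
      "ff_L X q = \<sigma> * (a20 * u\<^sub>1\<^sup>2 + a02 * v\<^sub>1\<^sup>2)"
      "ff_M X q = \<sigma> * (a20 * u\<^sub>1 * u\<^sub>2 + a02 * v\<^sub>1 * v\<^sub>2)"
      "ff_N X q = \<sigma> * (a20 * u\<^sub>2\<^sup>2 + a02 * v\<^sub>2\<^sup>2)"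
    then show "ff_L X q = \<sigma> * a02 * ff_E X q \<and> ff_M X q = \<sigma> * a02 * ff_F X q \<and>
        ff_N X q = \<sigma> * a02 * ff_G X q"
      by (simp add: eq algebra_simps)
  qed
  then show "umbilic S p" unfolding umbilic_def using X by blast
qed

lemma flat_umbilic_adapted:
  assumes "regular_surface S" "p \<in> S" and ad: "adapted_coordinates S p A 0 0"
  shows "flat_umbilic S p"
proof -
  obtain U X q where X: "local_parametrization S U X" "q \<in> U" "X q = p"
    using assms(1,2) unfolding regular_surface_def by (metis imageE)
  have "ff_L X q = 0 \<and> ff_M X q = 0 \<and> ff_N X q = 0"
    by (rule fundamental_forms_in_adapted_coordinates[OF ad X]) simp
  then show ?thesis unfolding flat_umbilic_def using X by blast
qed

section \<open>The algebra of contour-conjugacy\<close>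

text \<open>
  The defining equation factors; injectivity of \<open>direction A\<close> on the open interval identifies the
  angles that witness contour-conjugacy with \<open>\<theta>\<^sub>1\<close> and \<open>\<theta>\<^sub>2\<close>.
\<close>

lemma contour_conjugate_direction_iff:
  assumes "orthogonal_transformation A" "a20 * a02 \<noteq> 0"
    and "\<theta>\<^sub>1 \<in> {0<..<pi}" "\<theta>\<^sub>2 \<in> {0<..<pi}"
  shows "contour_conjugate A a20 a02 (direction A \<theta>\<^sub>1) (direction A \<theta>\<^sub>2) \<longleftrightarrow>
    a20 = a02 \<or> a20 * (cos \<theta>\<^sub>1)\<^sup>2 * (cos \<theta>\<^sub>2)\<^sup>2 = a02 * (sin \<theta>\<^sub>1)\<^sup>2 * (sin \<theta>\<^sub>2)\<^sup>2"
proof -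
  define \<kappa> where "\<kappa> \<theta> = a20 * (cos \<theta>)\<^sup>2 + a02 * (sin \<theta>)\<^sup>2" for \<theta>
  have key: "\<kappa> \<theta>\<^sub>1 * \<kappa> \<theta>\<^sub>2 - a20 * a02 =
    (a20 - a02) * (a20 * (cos \<theta>\<^sub>1)\<^sup>2 * (cos \<theta>\<^sub>2)\<^sup>2 - a02 * (sin \<theta>\<^sub>1)\<^sup>2 * (sin \<theta>\<^sub>2)\<^sup>2)"
    unfolding \<kappa>_def cos_squared_eq by algebra
  have "contour_conjugate A a20 a02 (direction A \<theta>\<^sub>1) (direction A \<theta>\<^sub>2) \<longleftrightarrow>
      a20 * a02 / (\<kappa> \<theta>\<^sub>1 * \<kappa> \<theta>\<^sub>2) = 1"
    unfolding contour_conjugate_def \<kappa>_def using assms direction_inj[OF assms(1)] by metis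
  also have "\<dots> \<longleftrightarrow> \<kappa> \<theta>\<^sub>1 * \<kappa> \<theta>\<^sub>2 - a20 * a02 = 0"
    using assms(2) by (auto simp: divide_eq_1_iff)
  finally show ?thesis unfolding key by auto
qed

text \<open>
  With \<open>P = a20 cos\<^sup>2 \<theta>\<^sub>1\<close> and \<open>Q = a02 sin\<^sup>2 \<theta>\<^sub>1\<close>, which have the same sign and are nonzero, the
  equation reads \<open>cos\<^sup>2 \<theta> = Q / (P + Q)\<close>. The right-hand side lies strictly between 0 and 1, so
  the two values \<open>\<plusminus> sqrt (Q / (P + Q))\<close> of the cosine are distinct and each is attained once.
\<close>

lemma card_contour_conjugates:
  assumes A: "orthogonal_transformation A" and pos: "a20 * a02 > 0" and ne: "a20 \<noteq> a02"
    and t1: "\<theta>\<^sub>1 \<in> {0<..<pi}" "\<theta>\<^sub>1 \<noteq> pi / 2"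
  shows "card {\<xi>\<in>directions A. contour_conjugate A a20 a02 (direction A \<theta>\<^sub>1) \<xi>} = 2"
proof -
  define P where "P = a20 * (cos \<theta>\<^sub>1)\<^sup>2"
  define Q where "Q = a02 * (sin \<theta>\<^sub>1)\<^sup>2"
  have "cos \<theta>\<^sub>1 \<noteq> 0" 
  proof
    assume "cos \<theta>\<^sub>1 = 0"
    then have "cos \<theta>\<^sub>1 = cos (pi / 2)" by simp
    then show False using cos_inj_pi[of \<theta>\<^sub>1 "pi / 2"] t1 by simp
  qed
  moreover have "sin \<theta>\<^sub>1 \<noteq> 0" using t1 sin_gt_zero[of \<theta>\<^sub>1] by auto
  ultimately have PQ: "P * Q > 0"
    using pos unfolding P_def Q_def by (metis mult.assoc mult.commute mult_pos_pos zero_less_power2)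
  define c where "c = Q / (P + Q)"
  have c: "0 < c" "c < 1" "P + Q \<noteq> 0"
    using PQ unfolding c_def by (auto simp: zero_less_mult_iff field_simps)
  define \<alpha> where "\<alpha> = arccos (sqrt c)"
  have \<alpha>: "0 < \<alpha>" "\<alpha> < pi / 2" "cos \<alpha> = sqrt c"
  proof -
    have s: "0 < sqrt c" "sqrt c < 1" "- 1 \<le> sqrt c"
      using c real_sqrt_gt_zero[of c] by (auto simp: less_imp_le intro: order_trans[of "-1" 0])
    show "cos \<alpha> = sqrt c" unfolding \<alpha>_def using s by (intro cos_arccos) linarith+
    show "0 < \<alpha>" unfolding \<alpha>_def using s arccos_less_arccos[of "sqrt c" 1] by simp
    show "\<alpha> < pi / 2" unfolding \<alpha>_def using s arccos_less_arccos[of 0 "sqrt c"] by simp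
  qed
  have iff: "contour_conjugate A a20 a02 (direction A \<theta>\<^sub>1) (direction A \<theta>) \<longleftrightarrow>
      \<theta> = \<alpha> \<or> \<theta> = pi - \<alpha>" if t: "\<theta> \<in> {0<..<pi}" for \<theta>
  proof -
    have "contour_conjugate A a20 a02 (direction A \<theta>\<^sub>1) (direction A \<theta>) \<longleftrightarrow>
        P * (cos \<theta>)\<^sup>2 = Q * (sin \<theta>)\<^sup>2"
      using contour_conjugate_direction_iff[OF A less_imp_neq[OF pos, symmetric] t1(1) t] ne
      by (simp add: P_def Q_def)
    also have "\<dots> \<longleftrightarrow> (cos \<theta>)\<^sup>2 = c"
      unfolding sin_squared_eq c_def using c(3) by (auto simp: field_simps)
    also have "\<dots> \<longleftrightarrow> (cos \<theta>)\<^sup>2 = (sqrt c)\<^sup>2" using c by simp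
    also have "\<dots> \<longleftrightarrow> cos \<theta> = cos \<alpha> \<or> cos \<theta> = cos (pi - \<alpha>)"
      by (simp add: power2_eq_iff \<alpha>)
    also have "\<dots> \<longleftrightarrow> \<theta> = \<alpha> \<or> \<theta> = pi - \<alpha>"
      using t \<alpha> cos_inj_pi[of \<theta> \<alpha>] cos_inj_pi[of \<theta> "pi - \<alpha>"] by auto
    finally show ?thesis .
  qed
  have "{\<xi>\<in>directions A. contour_conjugate A a20 a02 (direction A \<theta>\<^sub>1) \<xi>} =
      {direction A \<alpha>, direction A (pi - \<alpha>)}"
    using \<alpha> iff unfolding directions_def by auto
  moreover have "direction A \<alpha> \<noteq> direction A (pi - \<alpha>)"
    using direction_inj[OF A, of \<alpha> "pi - \<alpha>"] \<alpha> by auto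
  ultimately show ?thesis by simp
qed

text \<open>
  The sines are nonzero on the open interval. So the two sides of
  \<open>a20 cos\<^sup>2 \<theta>\<^sub>1 cos\<^sup>2 \<theta>\<^sub>2 = a02 sin\<^sup>2 \<theta>\<^sub>1 sin\<^sup>2 \<theta>\<^sub>2\<close> cannot agree when \<open>a20\<close> and \<open>a02\<close> have opposite
  signs; multiplying by \<open>a20\<close> makes this visible without distinguishing which one is negative.
\<close>

lemma not_contour_conjugate_if_hyperbolic:
  assumes A: "orthogonal_transformation A" and neg: "a20 * a02 < 0"
    and "\<xi>\<^sub>1 \<in> directions A" "\<xi>\<^sub>2 \<in> directions A"
  shows "\<not> contour_conjugate A a20 a02 \<xi>\<^sub>1 \<xi>\<^sub>2"
proof
  obtain \<theta>\<^sub>1 \<theta>\<^sub>2 where t: "\<theta>\<^sub>1 \<in> {0<..<pi}" "\<xi>\<^sub>1 = direction A \<theta>\<^sub>1"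
      "\<theta>\<^sub>2 \<in> {0<..<pi}" "\<xi>\<^sub>2 = direction A \<theta>\<^sub>2"
    using assms(3,4) unfolding directions_def by auto
  define C where "C = (cos \<theta>\<^sub>1 * cos \<theta>\<^sub>2)\<^sup>2"
  define D where "D = (sin \<theta>\<^sub>1 * sin \<theta>\<^sub>2)\<^sup>2"
  assume "contour_conjugate A a20 a02 \<xi>\<^sub>1 \<xi>\<^sub>2"
  then have "a20 = a02 \<or> a20 * C = a02 * D"
    using contour_conjugate_direction_iff[OF A less_imp_neq[OF neg] t(1,3)]
    unfolding t C_def D_def power_mult_distrib mult.assoc by blast
  moreover have "a20 \<noteq> a02" using neg by (metis not_square_less_zero)
  ultimately have "a20 * (a20 * C) = a20 * a02 * D" by simp
  moreover have "a20 * (a20 * C) \<ge> 0" unfolding C_def by (simp add: mult.assoc[symmetric])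
  moreover have "D > 0" unfolding D_def using t sin_gt_zero[of \<theta>\<^sub>1] sin_gt_zero[of \<theta>\<^sub>2] by auto
  then have "a20 * a02 * D < 0" using neg by (simp add: mult_less_0_iff)
  ultimately show False by linarith
qed

theorem proposition3p6:
  fixes S :: "(real^3) set" and p :: "real^3"
    and A :: "real^3 \<Rightarrow> real^3" and a20 a02 :: real
  assumes "regular_surface S" and "p \<in> S"
    and "adapted_coordinates S p A a20 a02"
    and "\<not> flat_umbilic S p"
  shows "(umbilic S p \<longrightarrow>
            (\<forall>\<xi>\<^sub>1\<in>directions A. \<forall>\<xi>\<^sub>2\<in>directions A. contour_conjugate A a20 a02 \<xi>\<^sub>1 \<xi>\<^sub>2)) \<and>
         (gaussian_curvature S p > 0 \<and> \<not> umbilic S p \<longrightarrow>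
            (\<forall>\<xi>\<^sub>1\<in>directions A. \<xi>\<^sub>1 \<noteq> direction A (pi / 2) \<longrightarrow>
               card {\<xi>\<^sub>2\<in>directions A. contour_conjugate A a20 a02 \<xi>\<^sub>1 \<xi>\<^sub>2} = 2)) \<and>
         (gaussian_curvature S p < 0 \<longrightarrow>
            (\<forall>\<xi>\<^sub>1\<in>directions A. \<not> (\<exists>\<xi>\<^sub>2\<in>directions A. contour_conjugate A a20 a02 \<xi>\<^sub>1 \<xi>\<^sub>2)))"
proof -
  have A: "orthogonal_transformation A" using assms(3) by (simp add: adapted_coordinates_def)
  have K: "gaussian_curvature S p = a20 * a02" by (rule gaussian_curvature_adapted[OF assms(1-3)])
  have umb: "umbilic S p \<longleftrightarrow> a20 = a02" by (rule umbilic_adapted[OF assms(1-3)])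
  have flat: "a20 \<noteq> 0 \<or> a02 \<noteq> 0" using flat_umbilic_adapted assms by blast
  show ?thesis
  proof (intro conjI impI ballI)
    fix \<xi>\<^sub>1 \<xi>\<^sub>2
    assume "umbilic S p" and \<xi>: "\<xi>\<^sub>1 \<in> directions A" "\<xi>\<^sub>2 \<in> directions A"
    with umb flat have "a20 = a02" "a20 * a02 \<noteq> 0" by auto
    then show "contour_conjugate A a20 a02 \<xi>\<^sub>1 \<xi>\<^sub>2"
      using contour_conjugate_direction_iff[OF A] \<xi> unfolding directions_def by blast
  next
    fix \<xi>\<^sub>1
    assume hyp: "gaussian_curvature S p > 0 \<and> \<not> umbilic S p"
      and \<xi>: "\<xi>\<^sub>1 \<in> directions A" "\<xi>\<^sub>1 \<noteq> direction A (pi / 2)"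
    obtain \<theta>\<^sub>1 where "\<theta>\<^sub>1 \<in> {0<..<pi}" "\<theta>\<^sub>1 \<noteq> pi / 2" "\<xi>\<^sub>1 = direction A \<theta>\<^sub>1"
      using \<xi> unfolding directions_def by blast
    then show "card {\<xi>\<^sub>2\<in>directions A. contour_conjugate A a20 a02 \<xi>\<^sub>1 \<xi>\<^sub>2} = 2"
      using card_contour_conjugates[OF A, of a20 a02] K umb hyp by metis
  next
    fix \<xi>\<^sub>1
    assume "gaussian_curvature S p < 0" "\<xi>\<^sub>1 \<in> directions A"
    then show "\<not> (\<exists>\<xi>\<^sub>2\<in>directions A. contour_conjugate A a20 a02 \<xi>\<^sub>1 \<xi>\<^sub>2)"
      using not_contour_conjugate_if_hyperbolic[OF A] K by auto
  qed
qed

end
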